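(* Consider the convex program of minimizing $F(\mathbf{x})$ over $\mathbf{x}\in\mathcal{X}$ subject to $G_k(\mathbf{x})\le 0$ for $k\in\{1,\dots,m\}$, with the data and standing assumptions described in the context, and suppose in addition that each $g_k$ is a linear function. Let $\mathbf{x}^\ast$ be an optimal solution and let $\boldsymbol{\lambda}^\ast\ge\mathbf{0}$ be a Lagrange multiplier vector attaining strong duality (as defined in the context). Run the algorithm described in the context with constant parameters $\alpha(t)=\alpha>\frac12[\beta^2+L_f]$ for all $t\ge 0$. Then for all $t\ge 1$: 1. $F(\overline{\mathbf{x}}(t))\le F(\mathbf{x}^\ast)+\frac{\alpha}{t}\Vert\mathbf{x}^\ast-\mathbf{x}(-1)\Vert^2$. 2. For every $k\in\{1,\dots,m\}$, $$G_k(\overline{\mathbf{x}}(t))\le\frac1t\Big[2\Vert\boldsymbol{\lambda}^\ast\Vert+\sqrt{2\alpha}\,\Vert\mathbf{x}^\ast-\mathbf{x}(-1)\Vert+\sqrt{\frac{\alpha}{\alpha-\frac12\beta^2-\frac12L_f}}\,\Vert\mathbf{G}(\mathbf{x}^\ast)\Vert\Big].$$ That is, the errors decay like $O(1/t)$: there is a constant $K$ (independent of $t$ and $\epsilon$) such that for every $\epsilon>0$ and every integer $t\ge 1$ with $t\ge K/\epsilon$, $F(\overline{\mathbf{x}}(t))\le F(\mathbf{x}^\ast)+\epsilon$ and $G_k(\overline{\mathbf{x}}(t))\le\epsilon$ for all $k$.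
   Context: Norm: $\Vert\cdot\Vert$ is the Euclidean norm. A function is separable if it is a sum of functions each involving disjoint components (or blocks) of $\mathbf{x}$. A function $\phi$ continuously differentiable on $\mathcal{X}$ is smooth on $\mathcal{X}$ with modulus $L\ge 0$ if $\nabla\phi$ is Lipschitz continuous on $\mathcal{X}$ with constant $L$. "Linear" for $g_k$ means of the form $g_k(\mathbf{x})=\mathbf{a}_k^{T}\mathbf{x}-b_k$. Problem: $n,m$ are positive integers and $\mathcal{X}\subseteq\mathbb{R}^n$ is a closed convex set. $F(\mathbf{x})=f(\mathbf{x})+\tilde f(\mathbf{x})$ with $f$ convex and smooth on $\mathcal{X}$ with modulus $L_f$, and $\tilde f$ convex and separable (possibly non-smooth) on $\mathcal{X}$. $G_k(\mathbf{x})=g_k(\mathbf{x})+\tilde g_k(\mathbf{x})$ for $k=1,\dots,m$, with $g_k$ convex, Lipschitz continuous and smooth on $\mathcal{X}$, and $\tilde g_k$ convex, Lipschitz continuous and separable (possibly non-smooth) on $\mathcal{X}$. Write $\mathbf{G}=[G_1,\dots,G_m]^{T}$. The program is $\min\{F(\mathbf{x}):\mathbf{x}\in\mathcal{X},\,G_k(\mathbf{x})\le0\ \forall k\}$. Standing assumptions: (i) an optimal solution $\mathbf{x}^\ast\in\mathcal{X}$ of the program exists (possibly non-unique); (ii) there is $\beta>0$ with $\Vert\mathbf{G}(\mathbf{x})-\mathbf{G}(\mathbf{y})\Vert\le\beta\Vert\mathbf{x}-\mathbf{y}\Vert$ for all $\mathbf{x},\mathbf{y}\in\mathcal{X}$;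 (iii) there is a vector $\boldsymbol{\lambda}^\ast\ge\mathbf{0}$ in $\mathbb{R}^m$ attaining strong duality, i.e. $q(\boldsymbol{\lambda}^\ast)=\min\{F(\mathbf{x}):\mathbf{x}\in\mathcal{X},\,G_k(\mathbf{x})\le0\ \forall k\}$, where $q(\boldsymbol{\lambda})=\min_{\mathbf{x}\in\mathcal{X}}\{F(\mathbf{x})+\sum_{k=1}^m\lambda_kG_k(\mathbf{x})\}$. Algorithm with positive parameters $\{\alpha(t)\}_{t\ge0}$: choose any $\mathbf{x}(-1)\in\mathcal{X}$ and set $Q_k(0)=\max\{0,-G_k(\mathbf{x}(-1))\}$ for all $k$. At each iteration $t\in\{0,1,2,\dots\}$: (a) let $\mathbf{x}(t)$ be a minimizer over $\mathbf{x}\in\mathcal{X}$ of $$[\nabla f(\mathbf{x}(t-1))]^{T}\mathbf{x}+\tilde f(\mathbf{x})+\sum_{k=1}^m[Q_k(t)+G_k(\mathbf{x}(t-1))]\big[[\nabla g_k(\mathbf{x}(t-1))]^{T}\mathbf{x}+\tilde g_k(\mathbf{x})\big]+\alpha(t)\Vert\mathbf{x}-\mathbf{x}(t-1)\Vert^2;$$ (b) set $Q_k(t+1)=\max\{-G_k(\mathbf{x}(t)),\,Q_k(t)+G_k(\mathbf{x}(t))\}$ for all $k$; (c) set $\overline{\mathbf{x}}(t+1)=\frac1{t+1}\sum_{\tau=0}^{t}\mathbf{x}(\tau)$. *)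

theory Defs
  imports "HOL-Analysis.Analysis" "HOL-Library.Disjoint_Sets"
begin

(* The gradient is an explicit map and derivatives are taken within X: X may have empty interior,
   and the functions matter on X only. If phi is differentiable on a neighbourhood of X, the
   ordinary gradient is an admissible choice of grad. Continuity of the gradient on X follows from
   the Lipschitz condition; lipschitz_on includes 0 <= L. *)
definition smooth_with_modulus ::
  "(real^'n) set \<Rightarrow> real \<Rightarrow> (real^'n \<Rightarrow> real) \<Rightarrow> (real^'n \<Rightarrow> real^'n) \<Rightarrow> bool" where
  "smooth_with_modulus X L \<phi> grad \<longleftrightarrow>
     (\<forall>x\<in>X. (\<phi> has_derivative (\<lambda>h. grad x \<bullet> h)) (at x within X)) \<and> L-lipschitz_on X grad"

(* P is the partition of the coordinates into blocks (singletons for full separability). *)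
definition separable_on ::
  "(real^'n) set \<Rightarrow> 'n set set \<Rightarrow> (real^'n \<Rightarrow> real) \<Rightarrow> bool" where
  "separable_on X P \<phi> \<longleftrightarrow>
     partition_on UNIV P \<and>
     (\<exists>\<psi> :: 'n set \<Rightarrow> real^'n \<Rightarrow> real.
        (\<forall>B\<in>P. \<forall>x y. (\<forall>i\<in>B. x $ i = y $ i) \<longrightarrow> \<psi> B x = \<psi> B y) \<and>
        (\<forall>x\<in>X. \<phi> x = (\<Sum>B\<in>P. \<psi> B x)))"

definition linear_function_on :: "(real^'n) set \<Rightarrow> (real^'n \<Rightarrow> real) \<Rightarrow> bool" where
  "linear_function_on X \<phi> \<longleftrightarrow> (\<exists>a b. \<forall>x\<in>X. \<phi> x = a \<bullet> x - b)"

definition feasible_set ::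
  "(real^'n) set \<Rightarrow> (real^'n \<Rightarrow> real^'m) \<Rightarrow> (real^'n) set" where
  "feasible_set X G = {x \<in> X. \<forall>k. G x $ k \<le> 0}"

definition is_minimum_value :: "('a \<Rightarrow> real) \<Rightarrow> 'a set \<Rightarrow> real \<Rightarrow> bool" where
  "is_minimum_value h S v \<longleftrightarrow> (\<exists>x. is_arg_min h (\<lambda>y. y \<in> S) x \<and> h x = v)"

(* The dual function is a relation (dual_value X F G lam v means q(lam) = v), because the
   minimum defining q(lam) need not exist for every lam. *)
definition dual_value ::
  "(real^'n) set \<Rightarrow> (real^'n \<Rightarrow> real) \<Rightarrow> (real^'n \<Rightarrow> real^'m) \<Rightarrow> real^'m \<Rightarrow> real \<Rightarrow> bool" where
  "dual_value X F G lam v \<longleftrightarrow> is_minimum_value (\<lambda>x. F x + (\<Sum>k\<in>UNIV. lam $ k * G x $ k)) X v"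

definition attains_strong_duality ::
  "(real^'n) set \<Rightarrow> (real^'n \<Rightarrow> real) \<Rightarrow> (real^'n \<Rightarrow> real^'m) \<Rightarrow> real^'m \<Rightarrow> bool" where
  "attains_strong_duality X F G lam \<longleftrightarrow>
     (\<forall>k. 0 \<le> lam $ k) \<and>
     (\<exists>v. dual_value X F G lam v \<and> is_minimum_value F (feasible_set X G) v)"

(* previous x0 x t is x(t-1), where x0 stands for x(-1). *)
definition previous :: "'a \<Rightarrow> (nat \<Rightarrow> 'a) \<Rightarrow> nat \<Rightarrow> 'a" where
  "previous x0 x t = (case t of 0 \<Rightarrow> x0 | Suc s \<Rightarrow> x s)"

definition algorithm_run ::
  "(real^'n) set \<Rightarrow> (real^'n \<Rightarrow> real^'n) \<Rightarrow> (real^'n \<Rightarrow> real) \<Rightarrow>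
   ('m \<Rightarrow> real^'n \<Rightarrow> real^'n) \<Rightarrow> ('m \<Rightarrow> real^'n \<Rightarrow> real) \<Rightarrow> (real^'n \<Rightarrow> real^'m::finite) \<Rightarrow>
   (nat \<Rightarrow> real) \<Rightarrow> real^'n \<Rightarrow> (nat \<Rightarrow> real^'n) \<Rightarrow> (nat \<Rightarrow> real^'m) \<Rightarrow> bool" where
  "algorithm_run X gradf ft gradg gt G \<alpha> x0 x Q \<longleftrightarrow>
     (\<forall>t. 0 < \<alpha> t) \<and>
     x0 \<in> X \<and>
     (\<forall>k. Q 0 $ k = max 0 (- (G x0 $ k))) \<and>
     (\<forall>t. let p = previous x0 x t in
        is_arg_min
          (\<lambda>y. gradf p \<bullet> y + ft y
             + (\<Sum>k\<in>UNIV. (Q t $ k + G p $ k) * (gradg k p \<bullet> y + gt k y))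
             + \<alpha> t * (norm (y - p))\<^sup>2)
          (\<lambda>y. y \<in> X) (x t)) \<and>
     (\<forall>t k. Q (Suc t) $ k = max (- (G (x t) $ k)) (Q t $ k + G (x t) $ k))"

(* Meaningful for t >= 1 only. *)
definition running_average :: "(nat \<Rightarrow> real^'n) \<Rightarrow> nat \<Rightarrow> real^'n" where
  "running_average x t = (1 / real t) *\<^sub>R (\<Sum>\<tau><t. x \<tau>)"

end

theory Submission
  imports Defs
begin

text \<open>
  Because each \<open>g k\<close> is linear, its linearization is exact: the sum in the subproblem of iteration \<open>t\<close>
  equals \<open>w \<bullet> G y\<close> up to a constant, with weights \<open>w = Q t + G p\<close>, where \<open>p = x(t - 1)\<close>. The
  queue update keeps these weights nonnegative, so the objective of the subproblem, with its term
  \<open>\<alpha> * (norm (y - p))\<^sup>2\<close>, is strongly convex. Comparing its minimizer \<open>x t\<close> with a feasible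
  point \<open>z\<close>, and passing from the linearization of \<open>f\<close> to \<open>f\<close> itself (convexity at \<open>z\<close>, Lipschitz
  gradient at \<open>x t\<close>), gives (\<open>prox_gradient_step\<close>)
  
    \<open>F (x t) + w \<bullet> G (x t) + (\<alpha> - Lf/2) |x t - p|\<^sup>2
        \<le> F z + w \<bullet> G z + \<alpha> |z - p|\<^sup>2 - \<alpha> |z - x t|\<^sup>2\<close>,
  
  and \<open>w \<bullet> G z \<le> 0\<close>.
  
  The term \<open>w \<bullet> G (x t)\<close> splits into \<open>Q t \<bullet> G (x t)\<close>, which is at least half the increase of
  \<open>|Q|\<^sup>2\<close> less \<open>|G (x t)|\<^sup>2\<close>, and \<open>G p \<bullet> G (x t)\<close>, which by polarization is
  \<open>(|G p|\<^sup>2 + |G (x t)|\<^sup>2 - |G p - G (x t)|\<^sup>2) / 2\<close>. The second part pays for half of the loss in the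
  first, so that only the telescoping difference \<open>(|G p|\<^sup>2 - |G (x t)|\<^sup>2) / 2\<close> is left; the last square
  is at most \<open>\<beta>\<^sup>2 |x t - p|\<^sup>2\<close> and is absorbed by the proximal term, as \<open>2 * \<alpha> \<ge> \<beta>\<^sup>2 + Lf\<close>.
  Hence (\<open>potential_decrease\<close>) the excess \<open>F (x t) - F z\<close> is at most the decrease of
  
    \<open>V t = (|Q t|\<^sup>2 - |G (x(t - 1))|\<^sup>2) / 2 + \<alpha> |z - x(t - 1)|\<^sup>2\<close>.
  
  Summing with \<open>z = xstar\<close>, the total excess is at most \<open>\<alpha> |xstar - x0|\<^sup>2 - V t\<close>. For \<open>t \<ge> 1\<close> the
  queues dominate the constraint values, so \<open>V t \<ge> 0\<close>, and Jensen's inequality gives the bound on the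
  objective.
  
  For the constraints, \<open>Q t\<close> dominates the accumulated values of \<open>G\<close>, so it suffices to bound
  \<open>|Q t|\<close> uniformly in \<open>t\<close>. Strong duality bounds the total excess below by
  \<open>- |lamstar| |Q t|\<close>, while \<open>V t\<close> is at least \<open>|Q t|\<^sup>2 / 2\<close> minus a constant. The summed
  inequality thus becomes a quadratic inequality in \<open>|Q t|\<close>, solved in \<open>queue_norm_bound\<close>.
\<close>

section \<open>First-order inequalities on a convex set\<close>

lemma has_real_derivative_along_segment:
  fixes \<phi> :: "'a::real_inner \<Rightarrow> real"
  assumes X: "convex X" and pz: "p \<in> X" "z \<in> X" and s: "s \<in> {0..1}"
    and D: "\<And>y. y \<in> X \<Longrightarrow> (\<phi> has_derivative (\<lambda>h. grad y \<bullet> h)) (at y within X)"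
  shows "((\<lambda>s. \<phi> (p + s *\<^sub>R (z - p))) has_real_derivative grad (p + s *\<^sub>R (z - p)) \<bullet> (z - p))
           (at s within {0..1})"
proof -
  define \<gamma> where "\<gamma> s = p + s *\<^sub>R (z - p)" for s
  have \<gamma>X: "\<gamma> ` {0..1} \<subseteq> X"
  proof
    fix y assume "y \<in> \<gamma> ` {0..1}"
    then obtain u where u: "0 \<le> u" "u \<le> 1" "y = (1 - u) *\<^sub>R p + u *\<^sub>R z"
      by (auto simp: \<gamma>_def algebra_simps)
    then show "y \<in> X"
      using convexD[OF X pz, of "1 - u" u] by simp
  qed
  have "(\<gamma> has_derivative (\<lambda>h. h *\<^sub>R (z - p))) (at s within {0..1})"
    unfolding \<gamma>_def by (auto intro!: derivative_eq_intros)
  moreover have "(\<phi> has_derivative (\<lambda>h. grad (\<gamma> s) \<bullet> h)) (at (\<gamma> s) within \<gamma> ` {0..1})"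
    using D \<gamma>X s by (blast intro: has_derivative_subset)
  ultimately have "(\<phi> \<circ> \<gamma> has_derivative (\<lambda>h. grad (\<gamma> s) \<bullet> h) \<circ> (\<lambda>h. h *\<^sub>R (z - p)))
      (at s within {0..1})"
    by (rule diff_chain_within)
  moreover have "(\<lambda>h. grad (\<gamma> s) \<bullet> h) \<circ> (\<lambda>h. h *\<^sub>R (z - p)) = (*) (grad (\<gamma> s) \<bullet> (z - p))"
    by (auto simp: fun_eq_iff mult.commute)
  ultimately show ?thesis
    by (simp add: has_field_derivative_def o_def \<gamma>_def)
qed

text \<open>
  The derivative is taken within \<open>X\<close>, which may have empty interior; only its values in the directions
  \<open>z - p\<close> with \<open>z \<in> X\<close> enter, and these are one-sided limits of difference quotients along a segment.
\<close>

lemma convex_on_above_tangent_within: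
  fixes \<phi> :: "'a::real_inner \<Rightarrow> real"
  assumes X: "convex X" and pz: "p \<in> X" "z \<in> X" and \<phi>: "convex_on X \<phi>"
    and D: "\<And>y. y \<in> X \<Longrightarrow> (\<phi> has_derivative (\<lambda>h. grad y \<bullet> h)) (at y within X)"
  shows "\<phi> p + grad p \<bullet> (z - p) \<le> \<phi> z"
proof -
  let ?\<gamma> = "\<lambda>s. p + s *\<^sub>R (z - p)"
  have "((\<lambda>s. \<phi> (?\<gamma> s)) has_real_derivative grad p \<bullet> (z - p)) (at 0 within {0..1})"
    using has_real_derivative_along_segment[OF X pz _ D, of 0] by simp
  then have lim: "((\<lambda>s. (\<phi> (?\<gamma> s) - \<phi> p) / s) \<longlongrightarrow> grad p \<bullet> (z - p)) (at 0 within {0..1})"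
    by (simp add: has_field_derivative_iff)
  have "\<forall>\<^sub>F s in at (0::real) within {0..1}. (\<phi> (?\<gamma> s) - \<phi> p) / s \<le> \<phi> z - \<phi> p"
    unfolding eventually_at_filter
  proof (rule always_eventually, intro allI impI)
    fix s :: real assume s: "s \<noteq> 0" "s \<in> {0..1}"
    have "\<phi> ((1 - s) *\<^sub>R p + s *\<^sub>R z) \<le> (1 - s) * \<phi> p + s * \<phi> z"
      using s pz by (intro convex_onD[OF \<phi>]) auto
    then show "(\<phi> (?\<gamma> s) - \<phi> p) / s \<le> \<phi> z - \<phi> p"
      using s by (simp add: field_simps)
  qed
  moreover have "at (0::real) within {0..1} \<noteq> bot"
    by (simp add: trivial_limit_within islimpt_Icc)
  ultimately have "grad p \<bullet> (z - p) \<le> \<phi> z - \<phi> p"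
    using lim by (blast intro: tendsto_upperbound)
  then show ?thesis by simp
qed

lemma convex_on_affine:
  fixes a :: "'a::real_inner"
  assumes "convex X" and "\<And>y. y \<in> X \<Longrightarrow> \<phi> y = a \<bullet> y + c"
  shows "convex_on X \<phi>"
proof (rule convex_onI)
  fix t y z assume t: "0 < t" "t < (1::real)" and yz: "y \<in> X" "z \<in> X"
  have "(1 - t) *\<^sub>R y + t *\<^sub>R z \<in> X"
    using convexD[OF assms(1) yz, of "1 - t" t] t by simp
  then show "\<phi> ((1 - t) *\<^sub>R y + t *\<^sub>R z) \<le> (1 - t) * \<phi> y + t * \<phi> z"
    using yz by (simp add: assms(2) algebra_simps inner_simps)
qed (rule assms(1))

lemma convex_on_sum_fun:
  assumes "finite I" "convex X" "\<And>i. i \<in> I \<Longrightarrow> convex_on X (h i)"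
  shows "convex_on X (\<lambda>y. \<Sum>i\<in>I. h i y)"
  using assms(1,3)
  by (induction I rule: finite_induct) (auto intro!: convex_on_add simp: convex_on_const assms(2))

text \<open>
  When \<open>X\<close> spans a proper affine subspace, \<open>grad p\<close> need not be the coefficient vector of \<open>\<phi>\<close>: it is
  determined only in the directions that stay in \<open>X\<close>. In these directions the tangent inequality for
  \<open>\<phi>\<close> and the one for \<open>- \<phi>\<close> leave no freedom.
\<close>

lemma linear_function_on_tangent:
  assumes X: "convex X" and pz: "p \<in> X" "z \<in> X" and lin: "linear_function_on X \<phi>"
    and D: "\<And>y. y \<in> X \<Longrightarrow> (\<phi> has_derivative (\<lambda>h. grad y \<bullet> h)) (at y within X)"
  shows "\<phi> p + grad p \<bullet> (z - p) = \<phi> z"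
proof -
  obtain a b where ab: "\<And>y. y \<in> X \<Longrightarrow> \<phi> y = a \<bullet> y - b"
    using lin by (auto simp: linear_function_on_def)
  have "\<phi> p + grad p \<bullet> (z - p) \<le> \<phi> z"
    using ab by (intro convex_on_above_tangent_within[OF X pz _ D] convex_on_affine[OF X, of _ a "- b"]) auto
  moreover have "- \<phi> p + (- grad p) \<bullet> (z - p) \<le> - \<phi> z"
  proof (rule convex_on_above_tangent_within[OF X pz, where grad = "\<lambda>y. - grad y"])
    show "convex_on X (\<lambda>y. - \<phi> y)"
      using ab by (intro convex_on_affine[OF X, of _ "- a" b]) auto
    show "((\<lambda>y. - \<phi> y) has_derivative (\<lambda>h. (- grad y) \<bullet> h)) (at y within X)" if "y \<in> X" for y
      using has_derivative_minus[OF D[OF that]] by simp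
  qed
  ultimately show ?thesis by simp
qed

text \<open>
  The mean value theorem on the segment, applied to the difference of the two sides: its derivative has
  a sign because the gradient moves by at most \<open>L * s * norm (z - p)\<close> up to time \<open>s\<close>.
\<close>

lemma smooth_descent:
  assumes X: "convex X" and pz: "p \<in> X" "z \<in> X" and sm: "smooth_with_modulus X L \<phi> grad"
  shows "\<phi> z \<le> \<phi> p + grad p \<bullet> (z - p) + L / 2 * (norm (z - p))\<^sup>2"
proof -
  let ?\<gamma> = "\<lambda>s. p + s *\<^sub>R (z - p)"
  define \<psi> where "\<psi> s = \<phi> (?\<gamma> s) - s * (grad p \<bullet> (z - p)) - L / 2 * s\<^sup>2 * (norm (z - p))\<^sup>2" for s
  define \<psi>' where "\<psi>' s = grad (?\<gamma> s) \<bullet> (z - p) - grad p \<bullet> (z - p) - L * s * (norm (z - p))\<^sup>2" for s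
  have D: "\<And>y. y \<in> X \<Longrightarrow> (\<phi> has_derivative (\<lambda>h. grad y \<bullet> h)) (at y within X)"
    and lip: "L-lipschitz_on X grad"
    using sm by (auto simp: smooth_with_modulus_def)
  have "(\<psi> has_real_derivative \<psi>' s) (at s within {0..1})" if "0 \<le> s" "s \<le> 1" for s
    unfolding \<psi>_def \<psi>'_def using that
    by (auto intro!: derivative_eq_intros has_real_derivative_along_segment[OF X pz _ D])
  then have "\<exists>s\<in>{0<..<1}. \<psi> 1 - \<psi> 0 = \<psi>' s * (1 - 0)"
    by (intro mvt_simple) (auto simp: has_field_derivative_def)
  then obtain s where s: "0 < s" "s < 1" "\<psi> 1 - \<psi> 0 = \<psi>' s"
    by auto
  have "?\<gamma> s = (1 - s) *\<^sub>R p + s *\<^sub>R z"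
    by (simp add: algebra_simps)
  then have \<gamma>X: "?\<gamma> s \<in> X"
    using convexD[OF X pz, of "1 - s" s] s by simp
  have "grad (?\<gamma> s) \<bullet> (z - p) - grad p \<bullet> (z - p) \<le> norm (grad (?\<gamma> s) - grad p) * norm (z - p)"
    by (metis inner_diff_left norm_cauchy_schwarz)
  also have "norm (grad (?\<gamma> s) - grad p) \<le> L * norm (?\<gamma> s - p)"
    using lipschitz_onD[OF lip \<gamma>X pz(1)] by (simp add: dist_norm)
  finally have "\<psi>' s \<le> 0"
    using s by (simp add: \<psi>'_def mult_right_mono power2_eq_square mult.assoc)
  then show ?thesis
    using s by (simp add: \<psi>_def)
qed

section \<open>The proximal gradient step\<close>

text \<open>
  On a segment the squared norm lies below its chord by exactly a multiple of the squared length, and this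
  defect survives as growth away from the minimizer. Comparing \<open>x\<close> with \<open>u *\<^sub>R x + (1 - u) *\<^sub>R z\<close> gives the growth with the factor \<open>u < 1\<close>, and \<open>u\<close>
  may be taken arbitrarily close to \<open>1\<close>.
\<close>

lemma prox_minimizer_growth:
  fixes r :: "'a::real_inner \<Rightarrow> real"
  assumes r: "convex_on X r" and z: "z \<in> X"
    and x: "is_arg_min (\<lambda>y. r y + \<alpha> * (norm (y - p))\<^sup>2) (\<lambda>y. y \<in> X) x"
  shows "r x + \<alpha> * (norm (x - p))\<^sup>2 + \<alpha> * (norm (z - x))\<^sup>2 \<le> r z + \<alpha> * (norm (z - p))\<^sup>2"
proof -
  define H where "H y = r y + \<alpha> * (norm (y - p))\<^sup>2" for y
  have xX: "x \<in> X" and min: "\<And>y. y \<in> X \<Longrightarrow> H x \<le> H y"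
    using x by (auto simp: is_arg_min_linorder H_def)
  have X: "convex X"
    using r by (rule convex_on_imp_convex)
  have "u * (\<alpha> * (norm (z - x))\<^sup>2) \<le> H z - H x" if u: "0 < u" "u < 1" for u
  proof -
    define y where "y = u *\<^sub>R x + (1 - u) *\<^sub>R z"
    have "y \<in> X"
      unfolding y_def using convexD[OF X xX z, of u "1 - u"] u by simp
    have "r y \<le> u * r x + (1 - u) * r z"
      using convex_onD[OF r, of "1 - u" x z] xX z u by (simp add: y_def)
    moreover have "(norm (y - p))\<^sup>2
        = u * (norm (x - p))\<^sup>2 + (1 - u) * (norm (z - p))\<^sup>2 - u * (1 - u) * (norm (z - x))\<^sup>2"
      by (simp add: y_def power2_norm_eq_inner inner_simps inner_commute algebra_simps)
    then have "\<alpha> * (norm (y - p))\<^sup>2 = u * (\<alpha> * (norm (x - p))\<^sup>2) + (1 - u) * (\<alpha> * (norm (z - p))\<^sup>2)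
        - u * (1 - u) * (\<alpha> * (norm (z - x))\<^sup>2)"
      by (simp add: right_diff_distrib distrib_left mult.left_commute)
    ultimately have "H y \<le> u * H x + (1 - u) * H z - u * (1 - u) * (\<alpha> * (norm (z - x))\<^sup>2)"
      by (simp add: H_def algebra_simps)
    then have "(1 - u) * (u * (\<alpha> * (norm (z - x))\<^sup>2)) \<le> (1 - u) * (H z - H x)"
      using min[OF \<open>y \<in> X\<close>] by (simp add: algebra_simps)
    then show ?thesis
      using u by simp
  qed
  then have "\<alpha> * (norm (z - x))\<^sup>2 \<le> H z - H x"
    by (rule field_le_mult_one_interval)
  then show ?thesis
    by (simp add: H_def)
qed

text \<open>
  Replacing \<open>f\<close> by its linearization at \<open>p\<close> favours \<open>z\<close>, by convexity, and costs at most
  \<open>L / 2 * (norm (x - p))\<^sup>2\<close> at \<open>x\<close>, by smoothness; the latter is charged to the proximal term.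
\<close>

lemma prox_gradient_step:
  assumes X: "convex X" and f: "convex_on X f" "smooth_with_modulus X L f gradf"
    and r: "convex_on X r" and pz: "p \<in> X" "z \<in> X"
    and x: "is_arg_min (\<lambda>y. gradf p \<bullet> y + r y + \<alpha> * (norm (y - p))\<^sup>2) (\<lambda>y. y \<in> X) x"
  shows "f x + r x + (\<alpha> - L / 2) * (norm (x - p))\<^sup>2 + \<alpha> * (norm (z - x))\<^sup>2
           \<le> f z + r z + \<alpha> * (norm (z - p))\<^sup>2"
proof -
  have xX: "x \<in> X"
    using x by (simp add: is_arg_min_def)
  have D: "\<And>y. y \<in> X \<Longrightarrow> (f has_derivative (\<lambda>h. gradf y \<bullet> h)) (at y within X)"
    using f(2) by (auto simp: smooth_with_modulus_def)
  have "convex_on X (\<lambda>y. gradf p \<bullet> y + r y)"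
    by (intro convex_on_add r convex_on_affine[OF X, of _ "gradf p" 0]) auto
  from prox_minimizer_growth[OF this pz(2) x]
  have "gradf p \<bullet> x + r x + \<alpha> * (norm (x - p))\<^sup>2 + \<alpha> * (norm (z - x))\<^sup>2
      \<le> gradf p \<bullet> z + r z + \<alpha> * (norm (z - p))\<^sup>2" .
  moreover have "f p + gradf p \<bullet> (z - p) \<le> f z"
    by (rule convex_on_above_tangent_within[OF X pz f(1) D])
  moreover have "f x \<le> f p + gradf p \<bullet> (x - p) + L / 2 * (norm (x - p))\<^sup>2"
    by (rule smooth_descent[OF X pz(1) xX f(2)])
  ultimately show ?thesis
    by (simp add: inner_diff_right left_diff_distrib)
qed

section \<open>Virtual queues\<close>

text \<open>
  If the maximum is \<open>q + v\<close>, the right-hand side has a surplus of \<open>v\<^sup>2\<close>; if it is \<open>- v\<close>, the surplus is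
  \<open>(q + v)\<^sup>2\<close>.
\<close>

lemma queue_drift:
  fixes q v :: real
  shows "(max (- v) (q + v))\<^sup>2 \<le> q\<^sup>2 + 2 * (q * v) + 2 * v\<^sup>2"
proof -
  have "0 \<le> (q + v)\<^sup>2" "0 \<le> v\<^sup>2" by simp_all
  then show ?thesis
    by (auto simp: max_def power2_eq_square algebra_simps)
qed

text \<open>
  Here \<open>u\<close> and \<open>v\<close> stand for the previous and the new constraint values. The part \<open>u \<bullet> v\<close> contributed by
  the weight \<open>Q + u\<close> cancels half of the error \<open>2 * (norm v)\<^sup>2\<close> of the plain drift bound, so that the
  squared norms of \<open>u\<close> and \<open>v\<close> appear as a telescoping difference.
\<close>

lemma queue_drift_vec:
  fixes Q Q' u v :: "real^'m::finite"
  assumes Q': "\<And>k. Q' $ k = max (- (v $ k)) (Q $ k + v $ k)"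
  shows "(norm Q')\<^sup>2 - (norm Q)\<^sup>2 + (norm u)\<^sup>2 - (norm v)\<^sup>2 - (norm (u - v))\<^sup>2 \<le> 2 * ((Q + u) \<bullet> v)"
proof -
  have norm_sq: "(norm a)\<^sup>2 = (\<Sum>k\<in>UNIV. (a $ k)\<^sup>2)" for a :: "real^'m"
    unfolding power2_norm_eq_inner inner_vec_def by (simp add: power2_eq_square)
  have "(norm Q')\<^sup>2 = (\<Sum>k\<in>UNIV. (Q' $ k)\<^sup>2)"
    by (rule norm_sq)
  also have "\<dots> \<le> (\<Sum>k\<in>UNIV. (Q $ k)\<^sup>2 + 2 * (Q $ k * v $ k) + 2 * (v $ k)\<^sup>2)"
    unfolding Q' by (intro sum_mono queue_drift)
  also have "\<dots> = (norm Q)\<^sup>2 + 2 * (Q \<bullet> v) + 2 * (norm v)\<^sup>2"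
    by (simp add: norm_sq inner_vec_def sum.distrib sum_distrib_left)
  finally have "(norm Q')\<^sup>2 \<le> (norm Q)\<^sup>2 + 2 * (Q \<bullet> v) + 2 * (norm v)\<^sup>2" .
  moreover have "(norm (u - v))\<^sup>2 = (norm u)\<^sup>2 + (norm v)\<^sup>2 - 2 * (u \<bullet> v)"
    by (simp add: power2_norm_eq_inner inner_simps inner_commute)
  ultimately show ?thesis
    by (simp add: inner_add_left)
qed

lemma run_queue_update:
  assumes "algorithm_run X gradf ft gradg gt G \<alpha> x0 x Q"
  shows "Q (Suc t) $ k = max (- (G (x t) $ k)) (Q t $ k + G (x t) $ k)"
  using assms by (simp add: algorithm_run_def)

lemma run_previous_in:
  assumes "algorithm_run X gradf ft gradg gt G \<alpha> x0 x Q"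
  shows "previous x0 x t \<in> X"
  using assms by (auto simp: algorithm_run_def previous_def is_arg_min_def Let_def split: nat.splits)

lemma run_queue_nonneg:
  assumes "algorithm_run X gradf ft gradg gt G \<alpha> x0 x Q"
  shows "0 \<le> Q t $ k"
proof (induction t)
  case 0
  show ?case using assms by (simp add: algorithm_run_def)
next
  case (Suc t)
  then show ?case unfolding run_queue_update[OF assms] by linarith
qed

text \<open>
  This is what makes every subproblem convex, and what allows the constraints to be dropped at a feasible
  comparison point. The lower bound \<open>- G (x t) $ k\<close> in the queue update ensures it.
\<close>

lemma run_weight_nonneg:
  assumes "algorithm_run X gradf ft gradg gt G \<alpha> x0 x Q"
  shows "0 \<le> Q t $ k + G (previous x0 x t) $ k"
proof (cases t)
  case 0
  then show ?thesis using assms by (simp add: algorithm_run_def previous_def max_def)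
next
  case (Suc s)
  then show ?thesis by (simp add: run_queue_update[OF assms] previous_def max_def)
qed

lemma run_initial_queue_norm:
  assumes "algorithm_run X gradf ft gradg gt G \<alpha> x0 x Q"
  shows "norm (Q 0) \<le> norm (G x0)"
  using assms by (intro norm_le_componentwise_cart) (auto simp: algorithm_run_def max_def)

text \<open>
  In each component the new queue is at least \<open>- G (x t) $ k\<close> by the update, and at least \<open>G (x t) $ k\<close>
  because the old queue is nonnegative.
\<close>

lemma run_queue_norm:
  assumes "algorithm_run X gradf ft gradg gt G \<alpha> x0 x Q"
  shows "norm (G (x t)) \<le> norm (Q (Suc t))"
proof (rule norm_le_componentwise_cart)
  fix k
  show "norm (G (x t) $ k) \<le> norm (Q (Suc t) $ k)"
    using run_queue_nonneg[OF assms, of t k] unfolding run_queue_update[OF assms] by auto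
qed

lemma run_sum_constraint_le_queue:
  assumes "algorithm_run X gradf ft gradg gt G \<alpha> x0 x Q"
  shows "(\<Sum>\<tau><t. G (x \<tau>) $ k) \<le> Q t $ k"
proof (induction t)
  case 0
  show ?case using run_queue_nonneg[OF assms] by simp
next
  case (Suc t)
  then show ?case unfolding run_queue_update[OF assms] by simp
qed

section \<open>The potential\<close>

text \<open>
  The argument \<open>z\<close> is the comparison point, \<open>p\<close> the previous iterate and \<open>q\<close> the current queue vector.
  The negative term is the telescoping remainder of the drift bound.
\<close>

definition potential ::
  "(real^'n \<Rightarrow> real^'m::finite) \<Rightarrow> real \<Rightarrow> real^'n \<Rightarrow> real^'n \<Rightarrow> real^'m \<Rightarrow> real" where
  "potential G \<alpha> z p q = ((norm q)\<^sup>2 - (norm (G p))\<^sup>2) / 2 + \<alpha> * (norm (z - p))\<^sup>2"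

text \<open>
  The proximal step is applied to the weighted constraint sum as the non-smooth part. The assumption on
  \<open>\<alpha>\<close> is what lets the proximal term absorb both the linearization error of \<open>f\<close> and the variation
  of \<open>G\<close> between consecutive iterates.
\<close>

lemma potential_decrease:
  fixes G :: "real^'n \<Rightarrow> real^'m::finite"
  assumes X: "convex X"
    and G: "\<And>y k. G y $ k = g k y + gt k y"
    and f: "convex_on X f" "smooth_with_modulus X L f gradf"
    and ft: "convex_on X ft"
    and g: "\<And>k. \<exists>L. smooth_with_modulus X L (g k) (gradg k)" "\<And>k. linear_function_on X (g k)"
    and gt: "\<And>k. convex_on X (gt k)"
    and lip: "\<And>y z. y \<in> X \<Longrightarrow> z \<in> X \<Longrightarrow> norm (G y - G z) \<le> \<beta> * norm (y - z)"
    and alpha: "\<beta>\<^sup>2 + L \<le> 2 * \<alpha>"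
    and run: "algorithm_run X gradf ft gradg gt G (\<lambda>t. \<alpha>) x0 x Q"
    and z: "z \<in> feasible_set X G"
  shows "f (x t) + ft (x t) + potential G \<alpha> z (x t) (Q (Suc t))
    \<le> f z + ft z + potential G \<alpha> z (previous x0 x t) (Q t)"
proof -
  define p where "p = previous x0 x t"
  define w where "w = Q t + G p"
  define r where "r y = ft y + (\<Sum>k\<in>UNIV. w $ k * (gradg k p \<bullet> y + gt k y))" for y
  have w0: "0 \<le> w $ k" for k
    using run_weight_nonneg[OF run, of t k] by (simp add: w_def p_def)
  have pX: "p \<in> X" and xX: "x t \<in> X"
    using run_previous_in[OF run, of t] run_previous_in[OF run, of "Suc t"]
    by (simp_all add: p_def previous_def)
  have zX: "z \<in> X" and Gz: "G z $ k \<le> 0" for k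
    using z by (auto simp: feasible_set_def)
  have r_conv: "convex_on X r"
  proof -
    have "convex_on X (\<lambda>y. w $ k * (gradg k p \<bullet> y + gt k y))" for k
      by (intro convex_on_cmul w0 convex_on_add gt convex_on_affine[OF X, of _ "gradg k p" 0]) auto
    then have "convex_on X (\<lambda>y. \<Sum>k\<in>UNIV. w $ k * (gradg k p \<bullet> y + gt k y))"
      by (intro convex_on_sum_fun X finite)
    then show ?thesis
      unfolding r_def by (intro convex_on_add ft)
  qed
  have "is_arg_min (\<lambda>y. gradf p \<bullet> y + r y + \<alpha> * (norm (y - p))\<^sup>2) (\<lambda>y. y \<in> X) (x t)"
    using run unfolding algorithm_run_def Let_def p_def r_def w_def by (simp add: add.assoc)
  from prox_gradient_step[OF X f r_conv pX zX this]
  have step: "f (x t) + r (x t) + (\<alpha> - L / 2) * (norm (x t - p))\<^sup>2 + \<alpha> * (norm (z - x t))\<^sup>2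
      \<le> f z + r z + \<alpha> * (norm (z - p))\<^sup>2" .
  define c where "c = (\<Sum>k\<in>UNIV. w $ k * (gradg k p \<bullet> p - g k p))"
  have r_eq: "r y = ft y + w \<bullet> G y + c" if "y \<in> X" for y
  proof -
    have "gradg k p \<bullet> y + gt k y = G y $ k + (gradg k p \<bullet> p - g k p)" for k
    proof -
      obtain L' where "smooth_with_modulus X L' (g k) (gradg k)"
        using g(1) by blast
      then have "g k p + gradg k p \<bullet> (y - p) = g k y"
        by (intro linear_function_on_tangent[OF X pX that g(2)]) (simp add: smooth_with_modulus_def)
      then show ?thesis by (simp add: G inner_diff_right)
    qed
    then show ?thesis
      by (simp add: r_def c_def inner_vec_def distrib_left sum.distrib)
  qed
  have "w \<bullet> G z \<le> 0"
    unfolding inner_vec_def using w0 Gz by (auto intro!: sum_nonpos mult_nonneg_nonpos)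
  moreover have "(norm (Q (Suc t)))\<^sup>2 - (norm (Q t))\<^sup>2 + (norm (G p))\<^sup>2 - (norm (G (x t)))\<^sup>2
      - (norm (G p - G (x t)))\<^sup>2 \<le> 2 * (w \<bullet> G (x t))"
    unfolding w_def by (rule queue_drift_vec) (rule run_queue_update[OF run])
  moreover have "(norm (G p - G (x t)))\<^sup>2 \<le> \<beta>\<^sup>2 * (norm (x t - p))\<^sup>2"
    using power_mono[OF lip[OF pX xX], of 2] by (simp add: power_mult_distrib norm_minus_commute)
  moreover have "0 \<le> (2 * \<alpha> - L - \<beta>\<^sup>2) * (norm (x t - p))\<^sup>2"
    using alpha by (intro mult_nonneg_nonneg) auto
  ultimately show ?thesis
    using step r_eq[OF xX] r_eq[OF zX]
    unfolding potential_def p_def[symmetric] by (simp add: field_simps)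
qed

text \<open>
  Telescoping. The initial potential is at most \<open>\<alpha> * (norm (z - x0))\<^sup>2\<close>, since the initial queues are
  bounded by the initial constraint values.
\<close>

lemma run_sum_objective:
  fixes G :: "real^'n \<Rightarrow> real^'m::finite"
  assumes run: "algorithm_run X gradf ft gradg gt G \<alpha>' x0 x Q"
    and dec: "\<And>t. F (x t) + potential G \<alpha> z (x t) (Q (Suc t))
      \<le> F z + potential G \<alpha> z (previous x0 x t) (Q t)"
  shows "(\<Sum>\<tau><t. F (x \<tau>)) + potential G \<alpha> z (previous x0 x t) (Q t)
    \<le> real t * F z + \<alpha> * (norm (z - x0))\<^sup>2"
proof (induction t)
  case 0
  show ?case
    using power_mono[OF run_initial_queue_norm[OF run], of 2]
    by (simp add: potential_def previous_def)
next
  case (Suc t)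
  then show ?case
    using dec[of t] by (simp add: previous_def algebra_simps)
qed

section \<open>From the potential to the error bounds\<close>

lemma square_le_affine_imp_le:
  fixes q b s :: real
  assumes "q\<^sup>2 \<le> 2 * b * q + s" "0 \<le> b" "0 \<le> s"
  shows "q \<le> 2 * b + sqrt s"
proof (rule ccontr)
  assume "\<not> q \<le> 2 * b + sqrt s"
  then have "sqrt s < q - 2 * b" "sqrt s < q" using assms by auto
  then have "sqrt s * sqrt s < (q - 2 * b) * q"
    using assms by (intro mult_strict_mono') auto
  then show False
    using assms by (simp add: power2_eq_square algebra_simps)
qed

text \<open>
  Young's inequality, with the weight chosen so that the coefficient of \<open>r\<^sup>2\<close> is exactly twice the one
  in the potential: the difference of the two sides is a complete square divided by \<open>2 * \<alpha> - b\<^sup>2\<close>.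
\<close>

lemma square_add_le_weighted:
  fixes a b r \<alpha> :: real
  assumes "b\<^sup>2 < 2 * \<alpha>"
  shows "(a + b * r)\<^sup>2 \<le> 2 * \<alpha> * r\<^sup>2 + \<alpha> / (\<alpha> - b\<^sup>2 / 2) * a\<^sup>2"
proof -
  define \<delta> where "\<delta> = \<alpha> - b\<^sup>2 / 2"
  have \<delta>: "0 < \<delta>" "\<alpha> = \<delta> + b\<^sup>2 / 2"
    using assms by (auto simp: \<delta>_def)
  have "2 * \<alpha> * r\<^sup>2 + \<alpha> / \<delta> * a\<^sup>2 - (a + b * r)\<^sup>2 = (2 * \<delta> * r - a * b)\<^sup>2 / (2 * \<delta>)"
    using \<delta>(1) unfolding \<delta>(2) by (simp add: field_simps power2_eq_square)
  also have "\<dots> \<ge> 0" using \<delta> by simp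
  finally show ?thesis by (simp add: \<delta>_def)
qed

lemma convex_on_running_average:
  assumes "convex_on X h" "\<And>\<tau>. x \<tau> \<in> X" "1 \<le> t"
  shows "h (running_average x t) \<le> (\<Sum>\<tau><t. h (x \<tau>)) / real t"
proof -
  have "h (\<Sum>\<tau><t. (1 / real t) *\<^sub>R x \<tau>) \<le> (\<Sum>\<tau><t. 1 / real t * h (x \<tau>))"
    using assms by (intro convex_on_sum[where C = X]) (auto simp: lessThan_empty_iff)
  then show ?thesis
    by (simp add: running_average_def scaleR_sum_right sum_distrib_left[symmetric] sum_divide_distrib[symmetric])
qed

text \<open>
  The point \<open>z\<close> has the objective value \<open>v\<close> of the program, and \<open>v\<close> is also the minimum of the Lagrangian
  over \<open>X\<close>.
\<close>

lemma strong_duality_lower_bound: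
  fixes G :: "real^'n \<Rightarrow> real^'m::finite"
  assumes "attains_strong_duality X F G lam" "is_arg_min F (\<lambda>y. y \<in> feasible_set X G) z" "y \<in> X"
  shows "F z \<le> F y + lam \<bullet> G y"
proof -
  obtain v where "dual_value X F G lam v" "is_minimum_value F (feasible_set X G) v"
    using assms(1) by (auto simp: attains_strong_duality_def)
  then show ?thesis
    using assms(2,3)
    by (fastforce simp: dual_value_def is_minimum_value_def is_arg_min_linorder inner_vec_def)
qed

text \<open>
  The number \<open>V\<close> is the total excess of the objective, which duality bounds below by a multiple of
  \<open>norm q\<close>. The negative term of the potential is controlled through \<open>G z\<close> and the distance to \<open>z\<close>; the part
  involving that distance is cancelled by \<open>\<alpha> * (norm (z - p))\<^sup>2\<close>. What remains is a quadratic
  inequality in \<open>norm q\<close>.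
\<close>

lemma queue_norm_bound:
  fixes G :: "real^'n \<Rightarrow> real^'m::finite" and q :: "real^'m"
  assumes sum: "V + potential G \<alpha> z p q \<le> \<alpha> * D\<^sup>2" and V: "- (b * norm q) \<le> V"
    and nonneg: "0 \<le> b" "0 \<le> D" "0 \<le> L"
    and lip: "norm (G p - G z) \<le> \<beta> * norm (p - z)"
    and alpha: "\<beta>\<^sup>2 + L < 2 * \<alpha>"
  shows "norm q \<le> 2 * b + sqrt (2 * \<alpha>) * D + sqrt (\<alpha> / (\<alpha> - 1/2 * \<beta>\<^sup>2 - 1/2 * L)) * norm (G z)"
proof -
  define c where "c = \<alpha> / (\<alpha> - 1/2 * \<beta>\<^sup>2 - 1/2 * L)"
  have \<alpha>0: "0 < \<alpha>" and c0: "0 \<le> c"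
  proof -
    have "0 \<le> \<beta>\<^sup>2" by simp
    then show "0 < \<alpha>" using alpha nonneg by linarith
    then show "0 \<le> c" unfolding c_def using alpha by (intro divide_nonneg_nonneg) auto
  qed
  have "norm (G p) \<le> norm (G z) + \<beta> * norm (z - p)"
    using norm_triangle_sub[of "G p" "G z"] lip by (simp add: norm_minus_commute)
  then have "(norm (G p))\<^sup>2 \<le> (norm (G z) + \<beta> * norm (z - p))\<^sup>2"
    by (intro power_mono) auto
  also have "\<dots> \<le> 2 * \<alpha> * (norm (z - p))\<^sup>2 + \<alpha> / (\<alpha> - \<beta>\<^sup>2 / 2) * (norm (G z))\<^sup>2"
    using alpha nonneg by (intro square_add_le_weighted) auto
  also have "\<alpha> / (\<alpha> - \<beta>\<^sup>2 / 2) \<le> c"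
    unfolding c_def using alpha nonneg \<alpha>0 by (intro divide_left_mono) auto
  finally have "(norm (G p))\<^sup>2 \<le> 2 * \<alpha> * (norm (z - p))\<^sup>2 + c * (norm (G z))\<^sup>2"
    by (simp add: mult_right_mono)
  moreover have "2 * V + (norm q)\<^sup>2 - (norm (G p))\<^sup>2 + 2 * \<alpha> * (norm (z - p))\<^sup>2 \<le> 2 * \<alpha> * D\<^sup>2"
    using sum by (simp add: potential_def field_simps)
  ultimately have "(norm q)\<^sup>2 \<le> 2 * b * norm q + (2 * \<alpha> * D\<^sup>2 + c * (norm (G z))\<^sup>2)"
    using V by simp
  then have "norm q \<le> 2 * b + sqrt (2 * \<alpha> * D\<^sup>2 + c * (norm (G z))\<^sup>2)"
    using nonneg \<alpha>0 c0 by (intro square_le_affine_imp_le) auto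
  also have "sqrt (2 * \<alpha> * D\<^sup>2 + c * (norm (G z))\<^sup>2) \<le> sqrt (2 * \<alpha> * D\<^sup>2) + sqrt (c * (norm (G z))\<^sup>2)"
    using \<alpha>0 c0 by (intro sqrt_add_le_add_sqrt) auto
  also have "\<dots> = sqrt (2 * \<alpha>) * D + sqrt c * norm (G z)"
    using nonneg by (simp add: real_sqrt_mult)
  finally show ?thesis by (simp add: c_def)
qed

section \<open>Convergence rate\<close>

theorem theorem1:
  fixes X :: "(real^'n) set"
    and f ft F :: "real^'n \<Rightarrow> real"
    and g gt :: "'m::finite \<Rightarrow> real^'n \<Rightarrow> real"
    and G :: "real^'n \<Rightarrow> real^'m"
    and gradf :: "real^'n \<Rightarrow> real^'n"
    and gradg :: "'m \<Rightarrow> real^'n \<Rightarrow> real^'n"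
    and Pf :: "'n set set" and Pg :: "'m \<Rightarrow> 'n set set"
    and Lf \<beta> \<alpha> :: real
    and xstar x0 :: "real^'n" and lamstar :: "real^'m"
    and x :: "nat \<Rightarrow> real^'n" and Q :: "nat \<Rightarrow> real^'m"
  assumes X: "closed X" "convex X"
    and F: "\<And>y. F y = f y + ft y"
    and G: "\<And>y k. G y $ k = g k y + gt k y"
    and f: "convex_on X f" "smooth_with_modulus X Lf f gradf"
    and ft: "convex_on X ft" "separable_on X Pf ft"
    and g: "\<And>k. convex_on X (g k)" "\<And>k. \<exists>C. C-lipschitz_on X (g k)"
           "\<And>k. \<exists>L. smooth_with_modulus X L (g k) (gradg k)"
    and gt: "\<And>k. convex_on X (gt k)" "\<And>k. \<exists>C. C-lipschitz_on X (gt k)"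
            "\<And>k. separable_on X (Pg k) (gt k)"
    and g_linear: "\<And>k. linear_function_on X (g k)"
    and optimal: "is_arg_min F (\<lambda>y. y \<in> feasible_set X G) xstar"
    and beta: "0 < \<beta>" "\<And>y z. y \<in> X \<Longrightarrow> z \<in> X \<Longrightarrow> norm (G y - G z) \<le> \<beta> * norm (y - z)"
    and duality: "attains_strong_duality X F G lamstar"
    and alpha: "\<alpha> > 1/2 * (\<beta>\<^sup>2 + Lf)"
    and run: "algorithm_run X gradf ft gradg gt G (\<lambda>t. \<alpha>) x0 x Q"
  shows "(\<forall>t\<ge>1. F (running_average x t) \<le> F xstar + \<alpha> / real t * (norm (xstar - x0))\<^sup>2)
    \<and> (\<forall>t\<ge>1. \<forall>k. G (running_average x t) $ k \<le>
          1 / real t * (2 * norm lamstar + sqrt (2 * \<alpha>) * norm (xstar - x0)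
            + sqrt (\<alpha> / (\<alpha> - 1/2 * \<beta>\<^sup>2 - 1/2 * Lf)) * norm (G xstar)))
    \<and> (\<exists>K. \<forall>\<epsilon>>0. \<forall>t::nat. t \<ge> 1 \<and> real t \<ge> K / \<epsilon> \<longrightarrow>
          F (running_average x t) \<le> F xstar + \<epsilon> \<and>
          (\<forall>k. G (running_average x t) $ k \<le> \<epsilon>))"
proof -
  define D where "D = norm (xstar - x0)"
  define p where "p = previous x0 x"
  define B where "B = 2 * norm lamstar + sqrt (2 * \<alpha>) * D
    + sqrt (\<alpha> / (\<alpha> - 1/2 * \<beta>\<^sup>2 - 1/2 * Lf)) * norm (G xstar)"
  have Lf0: "0 \<le> Lf"
    using f(2) by (auto simp: smooth_with_modulus_def dest: lipschitz_on_nonneg)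
  have \<alpha>0: "0 < \<alpha>"
    using run by (simp add: algorithm_run_def)
  have z: "xstar \<in> feasible_set X G" "xstar \<in> X"
    using optimal by (auto simp: is_arg_min_def feasible_set_def)
  have pX: "p t \<in> X" for t
    unfolding p_def by (rule run_previous_in[OF run])
  have xX: "x t \<in> X" for t
    using pX[of "Suc t"] by (simp add: p_def previous_def)
  have F_conv: "convex_on X F"
    unfolding F[abs_def] by (rule convex_on_add[OF f(1) ft(1)])
  have G_conv: "convex_on X (\<lambda>y. G y $ k)" for k
    unfolding G by (intro convex_on_add g gt)
  have "F (x t) + potential G \<alpha> xstar (x t) (Q (Suc t))
      \<le> F xstar + potential G \<alpha> xstar (previous x0 x t) (Q t)" for t
    unfolding F using alpha
    by (intro potential_decrease[OF X(2) G f ft(1) g(3) g_linear gt(1) beta(2) _ run z(1)]) auto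
  then have sum_le: "(\<Sum>\<tau><t. F (x \<tau>)) + potential G \<alpha> xstar (p t) (Q t)
      \<le> real t * F xstar + \<alpha> * D\<^sup>2" for t
    unfolding p_def D_def by (rule run_sum_objective[OF run])

  have obj: "F (running_average x t) \<le> F xstar + \<alpha> / real t * D\<^sup>2" if t: "1 \<le> t" for t
  proof -
    \<comment> \<open>For \<open>t = 0\<close> the potential may be negative: the initial queues need not dominate \<open>G x0\<close>.\<close>
    obtain s where "t = Suc s" using t by (cases t) auto
    then have "0 \<le> potential G \<alpha> xstar (p t) (Q t)"
      using power_mono[OF run_queue_norm[OF run, of s], of 2] \<alpha>0
      by (simp add: potential_def p_def previous_def)
    then have "(\<Sum>\<tau><t. F (x \<tau>)) \<le> real t * F xstar + \<alpha> * D\<^sup>2"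
      using sum_le[of t] by linarith
    then have "(\<Sum>\<tau><t. F (x \<tau>)) / real t \<le> F xstar + \<alpha> / real t * D\<^sup>2"
      using t by (simp add: field_simps)
    then show ?thesis
      using convex_on_running_average[where x = x, OF F_conv xX t] by linarith
  qed

  have queue: "norm (Q t) \<le> B" for t
    unfolding B_def
  proof (rule queue_norm_bound[where G = G and z = xstar])
    show "((\<Sum>\<tau><t. F (x \<tau>)) - real t * F xstar) + potential G \<alpha> xstar (p t) (Q t) \<le> \<alpha> * D\<^sup>2"
      using sum_le[of t] by simp
    have "real t * F xstar = (\<Sum>\<tau><t. F xstar)" by simp
    also have "\<dots> \<le> (\<Sum>\<tau><t. F (x \<tau>) + lamstar \<bullet> G (x \<tau>))"
      by (intro sum_mono strong_duality_lower_bound[OF duality optimal] xX)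
    also have "\<dots> = (\<Sum>\<tau><t. F (x \<tau>)) + lamstar \<bullet> (\<Sum>\<tau><t. G (x \<tau>))"
      by (simp add: sum.distrib inner_sum_right)
    also have "lamstar \<bullet> (\<Sum>\<tau><t. G (x \<tau>)) \<le> lamstar \<bullet> Q t"
      unfolding inner_vec_def using duality run_sum_constraint_le_queue[OF run]
      by (auto intro!: sum_mono mult_left_mono simp: attains_strong_duality_def)
    also have "lamstar \<bullet> Q t \<le> norm lamstar * norm (Q t)"
      by (rule norm_cauchy_schwarz)
    finally show "- (norm lamstar * norm (Q t)) \<le> (\<Sum>\<tau><t. F (x \<tau>)) - real t * F xstar"
      by simp
    show "norm (G (p t) - G xstar) \<le> \<beta> * norm (p t - xstar)"
      by (rule beta(2)[OF pX z(2)])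
  qed (use alpha Lf0 in \<open>auto simp: D_def\<close>)

  have con: "G (running_average x t) $ k \<le> 1 / real t * B" if t: "1 \<le> t" for t k
  proof -
    have "G (running_average x t) $ k \<le> (\<Sum>\<tau><t. G (x \<tau>) $ k) / real t"
      by (rule convex_on_running_average[where x = x, OF G_conv xX t])
    also have "(\<Sum>\<tau><t. G (x \<tau>) $ k) \<le> B"
      using run_sum_constraint_le_queue[OF run, of k t] component_le_norm_cart[of "Q t" k]
        queue[of t] by linarith
    finally show ?thesis using t by (simp add: divide_right_mono)
  qed

  have "F (running_average x t) \<le> F xstar + \<epsilon> \<and> (\<forall>k. G (running_average x t) $ k \<le> \<epsilon>)"
    if "0 < \<epsilon>" "1 \<le> t" "max (\<alpha> * D\<^sup>2) B / \<epsilon> \<le> real t" for \<epsilon> t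
  proof -
    have "max (\<alpha> * D\<^sup>2) B / real t \<le> \<epsilon>"
      using that by (simp add: field_simps)
    moreover have "\<alpha> * D\<^sup>2 / real t \<le> max (\<alpha> * D\<^sup>2) B / real t" "B / real t \<le> max (\<alpha> * D\<^sup>2) B / real t"
      by (auto intro!: divide_right_mono)
    ultimately have "\<alpha> / real t * D\<^sup>2 \<le> \<epsilon>" "1 / real t * B \<le> \<epsilon>"
      by auto
    then show ?thesis
      using obj[OF that(2)] con[OF that(2)] by (meson add_left_mono order_trans)
  qed
  then show ?thesis
    using obj con unfolding B_def D_def by blast
qed

end
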